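(* Let $\mathcal B=\{2^ic_i,\,3^ic_i:i\in\mathbb N\}$, where $(c_i)_{i\in\mathbb N}$ are odd pairwise coprime positive integers not divisible by $3$. Assume that $2c_1<2^2c_2<2^3c_3<\dots$ are such that $$\sum_{i=1}^\infty\frac1{c_i}<\frac12,$$ and that there exists a real number $\alpha>1$ such that $c_j\le\alpha^j$ for all sufficiently large $j$. Let $\rho$ be the complexity function of $\eta=\mathbf 1_{\mathcal F_{\mathcal B}}$. Then, for each $\varepsilon\in(0,1)$, $$\liminf_{n\to+\infty}\frac{\rho(n)}{n^{\varepsilon\log_{2\alpha}\log_{2\alpha}n}}=+\infty .$$
   Context: $\mathbb N=\{1,2,\dots\}$. $\mathcal F_{\mathcal B}=\mathbb Z\setminus\bigcup_{b\in\mathcal B}b\mathbb Z$ is the set of $\mathcal B$-free numbers and $\eta\in\{0,1\}^{\mathbb Z}$ its characteristic function. The complexity function is $\rho(n)=|\{\eta[k+1,k+n]:k\in\mathbb Z\}|$, the number of distinct blocks of length $n$ occurring in $\eta$. $\log_{2\alpha}$ denotes the logarithm to base $2\alpha$. *)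

theory Defs
  imports Complex_Main "HOL-Library.Extended_Real" "HOL-Library.Indicator_Function"
begin

definition free_numbers :: "int set \<Rightarrow> int set" where
  "free_numbers B = UNIV - (\<Union>b\<in>B. {b * m | m. True})"

definition eta :: "int set \<Rightarrow> int \<Rightarrow> nat" where
  "eta B = indicator (free_numbers B)"

definition block :: "(int \<Rightarrow> 'a) \<Rightarrow> int \<Rightarrow> nat \<Rightarrow> 'a list" where
  "block x k n = map x [k + 1 .. k + int n]"

(* card is the true cardinality whenever x takes finitely many values, as eta does. *)
definition complexity :: "(int \<Rightarrow> 'a) \<Rightarrow> nat \<Rightarrow> nat" where
  "complexity x n = card {block x k n | k. True}"

(* The sequence c is indexed from 1; the value c 0 plays no role. *)
definition B_set :: "(nat \<Rightarrow> nat) \<Rightarrow> int set" where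
  "B_set c = {2 ^ i * int (c i) | i. i \<ge> 1} \<union> {3 ^ i * int (c i) | i. i \<ge> 1}"

end

theory Submission
  imports Defs "HOL-Number_Theory.Cong" "HOL-Real_Asymp.Real_Asymp"
begin

text \<open>
  If \<open>n \<ge> 12 K 2\<^sup>K c\<^sub>K\<close>, the block of length \<open>n\<close> starting after a multiple \<open>k\<close> of
  \<open>3 \<cdot> 2\<^bsup>K+1\<^esup>\<close> determines \<open>k\<close> modulo every \<open>c\<^sub>i\<close> with \<open>i \<le> K\<close>. Indeed, if \<open>k'\<close> is another such multiple
  with \<open>k' \<noteq> k\<close> modulo \<open>c\<^sub>i\<close>, consider offsets \<open>j\<close> that are divisible by \<open>2\<^sup>i\<close> but by neither
  \<open>2\<^bsup>i+1\<^esup>\<close> nor \<open>3\<close>, and satisfy \<open>c\<^sub>i | k + j\<close>. Then \<open>k + j\<close> is not free, and \<open>k' + j\<close> can only fail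
  to be free because some \<open>c\<^sub>l\<close> with \<open>l < i\<close> divides it; since the sum of the \<open>1 / c\<^sub>l\<close> is below \<open>1/2\<close>,
  a union bound leaves an admissible \<open>j \<le> n\<close>. Hence there are at least
  \<open>c\<^sub>1 \<cdots> c\<^sub>K \<ge> K!\<close> blocks of length \<open>n\<close>. As \<open>2\<^sup>K c\<^sub>K \<le> (2\<alpha>)\<^sup>K\<close>, one may take
  \<open>K = \<lfloor>\<delta> m\<rfloor>\<close> for \<open>m = log\<^bsub>2\<alpha>\<^esub> n\<close> and any \<open>\<delta> < 1\<close>; with \<open>\<delta> > \<epsilon>\<close>, \<open>K!\<close> outgrows
  \<open>m\<^bsup>\<epsilon> m\<^esup>\<close>, which is the denominator.
\<close>

section \<open>Blocks, complexity and values of \<open>eta\<close>\<close>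

lemma block_nth: "i < n \<Longrightarrow> block x k n ! i = x (k + 1 + int i)"
  by (simp add: block_def)

lemma block_eqD:
  assumes "block x k n = block x k' n" "1 \<le> j" "j \<le> int n"
  shows "x (k + j) = x (k' + j)"
proof -
  have "nat (j - 1) < n" "int (nat (j - 1)) = j - 1"
    using assms by auto
  then show ?thesis
    using block_nth[of "nat (j - 1)" n x] assms(1) by (metis add.assoc add_diff_cancel_left' diff_add_cancel)
qed

lemma card_le_complexity:
  assumes "finite (range x)" "inj_on (\<lambda>u. block x (k u) n) U"
  shows "card U \<le> complexity x n"
proof -
  \<comment> \<open>\<open>card\<close> is 0 on infinite sets, so finiteness of the set of blocks
    has to be secured before \<open>card_mono\<close> applies.\<close>
  have "finite {xs. set xs \<subseteq> range x \<and> length xs = n}"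
    using assms(1) by (rule finite_lists_length_eq)
  then have "finite {block x k n | k. True}"
    by (rule rev_finite_subset) (auto simp: block_def)
  then have "card ((\<lambda>u. block x (k u) n) ` U) \<le> card {block x k n | k. True}"
    by (intro card_mono) auto
  then show ?thesis
    using assms(2) by (simp add: complexity_def card_image)
qed

lemma finite_range_eta: "finite (range (eta B))"
  by (rule finite_subset[of _ "{0, 1}"]) (auto simp: eta_def indicator_def)

lemma eta_eq_1_iff: "eta B x = 1 \<longleftrightarrow> (\<forall>b\<in>B. \<not> b dvd x)"
  by (auto simp: eta_def indicator_def free_numbers_def dvd_def)

lemma eta_B_set_eq_1_iff:
  "eta (B_set c) x = 1 \<longleftrightarrow>
    (\<forall>i\<ge>1. \<not> 2 ^ i * int (c i) dvd x \<and> \<not> 3 ^ i * int (c i) dvd x)"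
  unfolding eta_eq_1_iff by (auto simp: B_set_def)

section \<open>Sieving an arithmetic progression\<close>

text \<open>Since \<open>q\<close> is invertible modulo \<open>d\<close>, all \<open>t\<close> that
  count lie in one residue class modulo \<open>d\<close>. They are therefore separated by the
  quotient \<open>t div d\<close>, which is at most \<open>T div d\<close>.\<close>

lemma card_multiples_progression_le:
  fixes a q :: int and d T :: nat
  assumes "coprime q (int d)" "d > 0"
  shows "card {t\<in>{..<T}. int d dvd a + q * int t} \<le> T div d + 1"
proof -
  let ?A = "{t\<in>{..<T}. int d dvd a + q * int t}"
  have "inj_on (\<lambda>t. t div d) ?A"
  proof (rule inj_onI)
    fix t t' assume t: "t \<in> ?A" "t' \<in> ?A" "t div d = t' div d"
    then have "int d dvd (a + q * int t) - (a + q * int t')"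
      by (intro dvd_diff) auto
    then have "int d dvd q * (int t - int t')"
      by (simp add: algebra_simps)
    then have "int d dvd int t - int t'"
      using assms(1) by (simp add: coprime_dvd_mult_right_iff coprime_commute)
    then have "t mod d = t' mod d"
      by (metis mod_eq_dvd_iff of_nat_eq_iff zmod_int)
    with t(3) show "t = t'"
      by (metis div_mult_mod_eq)
  qed
  moreover have "(\<lambda>t. t div d) ` ?A \<subseteq> {..T div d}"
    by (auto intro: div_le_mono)
  ultimately have "card ?A \<le> card {..T div d}"
    by (rule card_inj_on_le) simp
  then show ?thesis by simp
qed

text \<open>Union bound: if every \<open>t < T\<close> were hit by some \<open>c l\<close>, then
  \<open>T\<close> would be at most the sum of all \<open>T / c l + 1\<close>, hence at most
  \<open>T / 2 + card L\<close>, against \<open>2 * card L < T\<close>.\<close>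

lemma exists_progression_avoiding_multiples:
  fixes a q :: int and c :: "nat \<Rightarrow> nat"
  assumes fin: "finite L" and cop: "\<And>l. l \<in> L \<Longrightarrow> coprime q (int (c l))"
    and pos: "\<And>l. l \<in> L \<Longrightarrow> c l > 0"
    and sum: "(\<Sum>l\<in>L. 1 / real (c l)) \<le> 1 / 2" and T: "2 * card L < T"
  shows "\<exists>t<T. \<forall>l\<in>L. \<not> int (c l) dvd a + q * int t"
proof (rule ccontr)
  assume "\<not> ?thesis"
  then have "{..<T} \<subseteq> (\<Union>l\<in>L. {t\<in>{..<T}. int (c l) dvd a + q * int t})"
    by blast
  then have "card {..<T} \<le> card (\<Union>l\<in>L. {t\<in>{..<T}. int (c l) dvd a + q * int t})"
    using fin by (intro card_mono) auto
  also have "\<dots> \<le> (\<Sum>l\<in>L. card {t\<in>{..<T}. int (c l) dvd a + q * int t})"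
    using fin by (rule card_UN_le)
  also have "\<dots> \<le> (\<Sum>l\<in>L. T div c l + 1)"
    using cop pos by (intro sum_mono card_multiples_progression_le)
  finally have "real T \<le> real (\<Sum>l\<in>L. T div c l + 1)"
    by (simp only: card_lessThan of_nat_le_iff)
  also have "\<dots> = (\<Sum>l\<in>L. real (T div c l) + 1)"
    by (simp add: add.commute)
  also have "\<dots> \<le> (\<Sum>l\<in>L. real T * (1 / real (c l)) + 1)"
    by (intro sum_mono add_right_mono) (simp add: of_nat_div_le_of_nat)
  also have "\<dots> = real T * (\<Sum>l\<in>L. 1 / real (c l)) + card L"
    by (simp add: sum.distrib sum_distrib_left)
  also have "\<dots> \<le> real T * (1 / 2) + card L"
    using sum by (intro add_right_mono mult_left_mono) auto
  finally show False using T by simp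
qed

section \<open>Blocks determine residues modulo \<open>c i\<close>\<close>

lemma coprime_3_power_2:
  fixes d :: int
  assumes "odd d" "\<not> 3 dvd d"
  shows "coprime (3 * 2 ^ n) d"
proof -
  have "coprime 3 d"
    using assms by (simp add: prime_imp_coprime)
  then show ?thesis
    using assms(1) by (simp only: coprime_mult_left_iff coprime_power_left_iff coprime_left_2_iff_odd) simp
qed

lemma three_dvd_int_iff: "3 dvd int n \<longleftrightarrow> 3 dvd n"
  by presburger

text \<open>Chinese remaindering, twice: \<open>2 ^ i\<close> modulo \<open>2 ^ Suc i\<close> and 1
  modulo 3 combine to \<open>y\<close>, and \<open>y\<close> combines with \<open>- r\<close> modulo
  \<open>d\<close>.\<close>

lemma exists_residue_2_3:
  fixes d r :: int
  assumes "odd d" "\<not> 3 dvd d" "d > 0"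
  shows "\<exists>x. 1 \<le> x \<and> x \<le> 3 * 2 ^ Suc i * d \<and> 2 ^ i dvd x \<and> \<not> 2 ^ Suc i dvd x \<and> \<not> 3 dvd x \<and> d dvd x + r"
proof -
  have "coprime (2 ^ Suc i) (3 :: int)"
    by simp
  then obtain y where y: "[y = 2 ^ i] (mod 2 ^ Suc i)" "[y = 1] (mod (3::int))"
    using binary_chinese_remainder_int by blast
  have "coprime (3 * 2 ^ Suc i) d"
    using assms by (intro coprime_3_power_2)
  then obtain z where z: "[z = y] (mod 3 * 2 ^ Suc i)" "[z = - r] (mod d)"
    using binary_chinese_remainder_int by blast
  let ?q = "3 * 2 ^ Suc i * d"
  \<comment> \<open>Shifting by one before and after reducing gives a representative in
    1..\<open>?q\<close> instead of 0..\<open>?q - 1\<close>, because offsets in a block start at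
    1.\<close>
  define x where "x = (z - 1) mod ?q + 1"
  have q: "?q > 0" using assms by simp
  have "[x = (z - 1) + 1] (mod ?q)"
    unfolding x_def by (intro cong_add) (auto simp: cong_def)
  then have "[x = z] (mod ?q)" by simp
  then have xz: "[x = z] (mod 3 * 2 ^ Suc i)" "[x = z] (mod d)"
    by (auto intro: cong_dvd_modulus)
  have xy: "[x = y] (mod 3 * 2 ^ Suc i)"
    using xz(1) z(1) by (rule cong_trans)
  have x2: "[x = 2 ^ i] (mod 2 ^ Suc i)"
    by (rule cong_trans[OF _ y(1)]) (rule cong_dvd_modulus[OF xy], simp)
  have x3: "[x = 1] (mod 3)"
    by (rule cong_trans[OF _ y(2)]) (rule cong_dvd_modulus[OF xy], simp)
  have "2 ^ i dvd x"
    using cong_dvd_iff[OF cong_dvd_modulus[OF x2, of "2 ^ i"]] by simp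
  moreover have "\<not> 2 ^ Suc i dvd x"
    using cong_dvd_iff[OF x2] by (simp add: zdvd_not_zless)
  moreover have "\<not> 3 dvd x"
    using cong_dvd_iff[OF x3] by simp
  moreover have "d dvd x + r"
    using cong_trans[OF xz(2) z(2)] by (simp add: cong_iff_dvd_diff)
  moreover have "1 \<le> x" "x \<le> ?q"
    using pos_mod_bound[OF q, of "z - 1"] pos_mod_sign[OF q, of "z - 1"] by (auto simp: x_def)
  ultimately show ?thesis by blast
qed

lemma block_eq_imp_dvd_diff:
  fixes c :: "nat \<Rightarrow> nat"
  assumes pos: "\<And>i. i \<ge> 1 \<Longrightarrow> 0 < c i"
    and odd: "\<And>i. i \<ge> 1 \<Longrightarrow> odd (c i)"
    and three: "\<And>i. i \<ge> 1 \<Longrightarrow> \<not> 3 dvd c i"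
    and cop: "pairwise (\<lambda>i j. coprime (c i) (c j)) {1..}"
    and sum: "(\<Sum>l\<in>{1..<i}. 1 / real (c l)) \<le> 1 / 2"
    and i: "1 \<le> i" and n: "12 * i * 2 ^ i * c i \<le> n"
    and k: "3 * 2 ^ Suc i dvd k" "3 * 2 ^ Suc i dvd k'"
    and eq: "block (eta (B_set c)) k n = block (eta (B_set c)) k' n"
  shows "int (c i) dvd k - k'"
proof (rule ccontr)
  assume neq: "\<not> int (c i) dvd k - k'"
  let ?q = "3 * 2 ^ Suc i * int (c i)"
  obtain x where x: "1 \<le> x" "x \<le> ?q" "2 ^ i dvd x" "\<not> 2 ^ Suc i dvd x"
      "\<not> 3 dvd x" "int (c i) dvd x + k"
    using exists_residue_2_3[of "int (c i)" i k] pos[OF i] odd[OF i] three[OF i]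
    unfolding three_dvd_int_iff even_of_nat of_nat_0_less_iff by blast
  \<comment> \<open>Moving \<open>x\<close> by multiples of \<open>?q\<close> keeps all its
    divisibility properties. As \<open>{1..<i}\<close> has \<open>i - 1\<close> elements,
    \<open>2 * i\<close> candidates suffice, and the resulting offset is at most
    \<open>?q * (2 * i) = 12 * i * 2 ^ i * c i\<close>.\<close>
  have "\<exists>t<2 * i. \<forall>l\<in>{1..<i}. \<not> int (c l) dvd (k' + x) + ?q * int t"
  proof (rule exists_progression_avoiding_multiples)
    fix l assume l: "l \<in> {1..<i}"
    then have "coprime (3 * 2 ^ Suc i) (int (c l))"
      using three[of l] odd[of l] by (intro coprime_3_power_2) (auto simp: three_dvd_int_iff)
    moreover have "coprime (c i) (c l)"
      using cop l i by (auto simp: pairwise_def)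
    ultimately show "coprime ?q (int (c l))"
      by (simp only: coprime_mult_left_iff coprime_int_iff)
  qed (use sum i pos in auto)
  then obtain t where t: "t < 2 * i" "\<And>l. l \<in> {1..<i} \<Longrightarrow> \<not> int (c l) dvd (k' + x) + ?q * int t"
    by blast
  define j where "j = x + ?q * int t"
  have "j \<le> ?q * (int t + 1)"
    using x(2) by (simp add: j_def algebra_simps)
  also have "\<dots> \<le> ?q * (2 * int i)"
    using t(1) by (intro mult_left_mono) auto
  also have "\<dots> = int (12 * i * 2 ^ i * c i)"
    by simp
  also have "\<dots> \<le> int n"
    using n by (simp only: of_nat_le_iff)
  finally have jn: "j \<le> int n" .
  have "0 \<le> ?q * int t" by simp
  then have j1: "1 \<le> j"
    using x(1) unfolding j_def by linarith
  have k2: "2 ^ Suc i dvd k" "2 ^ Suc i dvd k'" and k3: "3 dvd k'"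
    using k by (auto elim: dvd_mult_left dvd_mult_right)
  have 2: "2 ^ i dvd ?q * int t" "2 ^ Suc i dvd ?q * int t" "3 dvd ?q * int t"
    by (auto simp: dvd_mult2 dvd_mult)
  have k2': "2 ^ i dvd k" using k2(1) by (auto elim: dvd_mult_right)
  have "2 ^ i dvd k + j"
    unfolding j_def using k2' 2 x(3) by (intro dvd_add)
  moreover have "int (c i) dvd k + j"
  proof -
    have "int (c i) dvd (x + k) + ?q * int t"
      by (rule dvd_add[OF x(6)]) simp
    then show ?thesis by (simp add: j_def algebra_simps)
  qed
  ultimately have "2 ^ i * int (c i) dvd k + j"
    using odd[OF i] by (intro divides_mult) auto
  then have "eta (B_set c) (k + j) \<noteq> 1"
    unfolding eta_B_set_eq_1_iff using i by blast
  \<comment> \<open>The generators with a power of 3 are excluded because 3 divides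
    \<open>k'\<close> and \<open>?q\<close> but not \<open>x\<close>. For those with a power of 2:
    \<open>l < i\<close> is excluded by the choice of \<open>t\<close>, \<open>l = i\<close> by
    \<open>neq\<close>, and \<open>l > i\<close> because \<open>2 ^ Suc i\<close> does not divide
    \<open>x\<close>.\<close>
  moreover have "eta (B_set c) (k' + j) = 1"
    unfolding eta_B_set_eq_1_iff
  proof (intro allI impI conjI notI)
    have not3: "\<not> 3 dvd k' + j"
      unfolding j_def using k3 2(3) x(5) by (metis dvd_add_left_iff dvd_add_right_iff)
    fix l :: nat assume l: "1 \<le> l"
    show False if "3 ^ l * int (c l) dvd k' + j"
    proof -
      have "(3::int) dvd 3 ^ l" using l by (intro dvd_power) auto
      with that not3 show False by (meson dvd_mult2 dvd_trans)
    qed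
    show False if dvd: "2 ^ l * int (c l) dvd k' + j"
    proof -
      have dl: "int (c l) dvd k' + j" "2 ^ l dvd k' + j"
        using dvd by (auto elim: dvd_mult_left dvd_mult_right)
      consider "l < i" | "l = i" | "l > i" by linarith
      then show False
      proof cases
        case 1
        then show False using t(2)[of l] l dl(1) by (simp add: j_def algebra_simps)
      next
        case 2
        then have "int (c i) dvd (k + j) - (k' + j)"
          using dl(1) \<open>int (c i) dvd k + j\<close> by (intro dvd_diff) auto
        then show False using neq by simp
      next
        case 3
        then have "2 ^ Suc i dvd k' + j"
          using dl(2) by (meson Suc_leI dvd_trans le_imp_power_dvd)
        then show False
          unfolding j_def using k2(2) 2(2) x(4) by (metis dvd_add_left_iff dvd_add_right_iff)
      qed
    qed
  qed
  ultimately show False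
    using block_eqD[OF eq j1 jn] by simp
qed

text \<open>The starting points \<open>3 * 2 ^ Suc K * u\<close> with \<open>u\<close> below the
  product give distinct blocks: equal blocks force congruence modulo each \<open>c i\<close>, the
  factor \<open>3 * 2 ^ Suc K\<close> cancels by coprimality, and the Chinese remainder theorem
  gives \<open>u = v\<close>.\<close>

lemma prod_le_complexity:
  fixes c :: "nat \<Rightarrow> nat"
  assumes pos: "\<And>i. i \<ge> 1 \<Longrightarrow> 0 < c i"
    and odd: "\<And>i. i \<ge> 1 \<Longrightarrow> odd (c i)"
    and three: "\<And>i. i \<ge> 1 \<Longrightarrow> \<not> 3 dvd c i"
    and cop: "pairwise (\<lambda>i j. coprime (c i) (c j)) {1..}"
    and sum: "\<And>i. (\<Sum>l\<in>{1..<i}. 1 / real (c l)) \<le> 1 / 2"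
    and n: "\<And>i. i \<in> {1..K} \<Longrightarrow> 12 * i * 2 ^ i * c i \<le> n"
  shows "(\<Prod>i\<in>{1..K}. c i) \<le> complexity (eta (B_set c)) n"
proof -
  define M where "M = (\<Prod>i\<in>{1..K}. c i)"
  define k where "k = (\<lambda>u::nat. 3 * 2 ^ Suc K * int u)"
  have "inj_on (\<lambda>u. block (eta (B_set c)) (k u) n) {..<M}"
  proof (rule inj_onI)
    fix u v assume uv: "u \<in> {..<M}" "v \<in> {..<M}"
      and eq: "block (eta (B_set c)) (k u) n = block (eta (B_set c)) (k v) n"
    have "[u = v] (mod c i)" if i: "i \<in> {1..K}" for i
    proof -
      have "3 * 2 ^ Suc i dvd k w" for w
        unfolding k_def using i by (intro dvd_mult2 mult_dvd_mono le_imp_power_dvd) auto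
      then have "int (c i) dvd k u - k v"
        using i by (intro block_eq_imp_dvd_diff[OF pos odd three cop sum _ n _ _ eq]) auto
      then have "int (c i) dvd (3 * 2 ^ Suc K) * (int u - int v)"
        by (simp add: k_def algebra_simps)
      moreover have "coprime (3 * 2 ^ Suc K) (int (c i))"
        using three[of i] odd[of i] i by (intro coprime_3_power_2) (auto simp: three_dvd_int_iff)
      then have "coprime (int (c i)) (3 * 2 ^ Suc K)"
        by (rule coprime_commute[THEN iffD1])
      ultimately have "int (c i) dvd int u - int v"
        by (simp only: coprime_dvd_mult_right_iff)
      then show ?thesis
        by (simp add: cong_iff_dvd_diff flip: cong_int_iff)
    qed
    then have "[u = v] (mod M)"
      unfolding M_def using cop by (intro coprime_cong_prod_nat) (auto simp: pairwise_def)
    then show "u = v"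
      using uv by (auto simp: cong_less_modulus_unique_nat)
  qed
  then show ?thesis
    using card_le_complexity[OF finite_range_eta] by (fastforce simp: M_def)
qed

section \<open>Factorial lower bounds\<close>

text \<open>The largest of \<open>m\<close> distinct positive integers is at least \<open>m\<close>;
  induction removes the maximum.\<close>

lemma fact_card_le_prod:
  fixes A :: "nat set"
  assumes "finite A" "0 \<notin> A"
  shows "fact (card A) \<le> \<Prod>A"
  using assms
proof (induction A rule: finite_linorder_max_induct)
  case (insert b A)
  have "insert b A \<subseteq> {1..b}"
  proof
    fix x assume x: "x \<in> insert b A"
    then have "x \<noteq> 0" using insert.prems by metis
    moreover have "x \<le> b" using x insert.hyps by auto
    ultimately show "x \<in> {1..b}" by simp
  qed
  then have "card (insert b A) \<le> b"
    using card_mono[of "{1..b}" "insert b A"] by simp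
  then have "card (insert b A) * fact (card A) \<le> b * \<Prod>A"
    using insert by (intro mult_mono) auto
  moreover have "b \<notin> A" using insert by auto
  ultimately show ?case
    using insert.hyps(1) by simp
qed simp

lemma exp_mult_ln_le_fact:
  fixes K :: nat
  shows "exp (real K * (ln (real K) - 1)) \<le> fact K"
proof (cases "K = 0")
  case False
  \<comment> \<open>A single term of the exponential series of \<open>exp K\<close>.\<close>
  have "real K ^ K / fact K \<le> exp (real K)"
    using sum_le_suminf[OF summable_exp_generic[of "real K"], of "{K}"]
    by (simp add: exp_def scaleR_conv_of_real field_simps)
  then have "real K ^ K / exp (real K) \<le> fact K"
    by (simp add: field_simps)
  moreover have "real K ^ K = exp (real K * ln (real K))"
    using False by (simp add: exp_of_nat_mult)
  ultimately show ?thesis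
    by (simp add: algebra_simps exp_diff)
qed simp

lemma fact_le_complexity:
  fixes c :: "nat \<Rightarrow> nat"
  assumes pos: "\<And>i. i \<ge> 1 \<Longrightarrow> 0 < c i"
    and odd: "\<And>i. i \<ge> 1 \<Longrightarrow> odd (c i)"
    and three: "\<And>i. i \<ge> 1 \<Longrightarrow> \<not> 3 dvd c i"
    and cop: "pairwise (\<lambda>i j. coprime (c i) (c j)) {1..}"
    and mono: "\<And>i. i \<ge> 1 \<Longrightarrow> 2 ^ i * c i < 2 ^ (i + 1) * c (i + 1)"
    and summ: "summable (\<lambda>i. 1 / real (c (Suc i)))"
    and half: "(\<Sum>i. 1 / real (c (Suc i))) < 1 / 2"
    and n: "12 * K * 2 ^ K * c K \<le> n"
  shows "fact K \<le> complexity (eta (B_set c)) n"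
proof -
  have sum: "(\<Sum>l\<in>{1..<i}. 1 / real (c l)) \<le> 1 / 2" for i
  proof -
    have "(\<Sum>l\<in>{1..<i}. 1 / real (c l)) = (\<Sum>l\<in>{..<i - 1}. 1 / real (c (Suc l)))"
      by (rule sum.reindex_bij_witness[of _ Suc "\<lambda>l. l - 1"]) auto
    also have "\<dots> \<le> (\<Sum>i. 1 / real (c (Suc i)))"
      by (intro sum_le_suminf summ) auto
    finally show ?thesis using half by simp
  qed
  \<comment> \<open>A value 1 would already push the sum of reciprocals above 1/2. Coprimality then
    makes the \<open>c i\<close> pairwise distinct.\<close>
  have gt1: "c i > 1" if "i \<ge> 1" for i
  proof (rule ccontr)
    assume "\<not> c i > 1"
    then have "c i = 1" using pos[OF that] by simp
    moreover have "(\<Sum>l\<in>{i}. 1 / real (c l)) \<le> (\<Sum>l\<in>{1..<Suc i}. 1 / real (c l))"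
      using that by (intro sum_mono2) auto
    ultimately show False using sum[of "Suc i"] by simp
  qed
  have inj: "inj_on c {1..K}"
  proof (rule inj_onI)
    fix i j assume ij: "i \<in> {1..K}" "j \<in> {1..K}" "c i = c j"
    show "i = j"
    proof (rule ccontr)
      assume "i \<noteq> j"
      then have "coprime (c i) (c j)" using ij by (intro pairwiseD[OF cop]) auto
      then have "c j = 1" using ij(3) by simp
      then show False using ij(2) gt1[of j] by simp
    qed
  qed
  \<comment> \<open>Monotonicity of \<open>2 ^ i * c i\<close> makes \<open>i = K\<close> the most
    demanding case.\<close>
  have "12 * i * 2 ^ i * c i \<le> n" if i: "i \<in> {1..K}" for i
  proof -
    have le: "2 ^ i * c i \<le> 2 ^ K * c K"
    proof (rule dec_induct[of i K])
      fix j assume "i \<le> j" "2 ^ i * c i \<le> 2 ^ j * c j"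
      moreover have "2 ^ j * c j < 2 ^ Suc j * c (Suc j)"
        using mono[of j] i \<open>i \<le> j\<close> by simp
      ultimately show "2 ^ i * c i \<le> 2 ^ Suc j * c (Suc j)" by linarith
    qed (use i in auto)
    have "(12 * i) * (2 ^ i * c i) \<le> (12 * K) * (2 ^ K * c K)"
      by (rule mult_le_mono[OF _ le]) (use i in simp)
    then show ?thesis using n by (simp add: mult.assoc)
  qed
  then have "(\<Prod>i\<in>{1..K}. c i) \<le> complexity (eta (B_set c)) n"
    by (intro prod_le_complexity pos odd three cop sum)
  moreover have "0 \<notin> c ` {1..K}"
    using pos by fastforce
  then have "fact K \<le> (\<Prod>i\<in>{1..K}. c i)"
    using fact_card_le_prod[of "c ` {1..K}"] inj by (simp add: card_image prod.reindex)
  ultimately show ?thesis by linarith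
qed

section \<open>Choice of \<open>K\<close> and asymptotics\<close>

theorem proposition3p30:
  fixes c :: "nat \<Rightarrow> nat" and \<alpha> \<epsilon> :: real
  assumes "\<And>i. i \<ge> 1 \<Longrightarrow> 0 < c i"
    and "\<And>i. i \<ge> 1 \<Longrightarrow> odd (c i)"
    and "\<And>i. i \<ge> 1 \<Longrightarrow> \<not> 3 dvd c i"
    and "pairwise (\<lambda>i j. coprime (c i) (c j)) {1..}"
    and "\<And>i. i \<ge> 1 \<Longrightarrow> 2 ^ i * c i < 2 ^ (i + 1) * c (i + 1)"
    and "summable (\<lambda>i. 1 / real (c (Suc i)))"
    and "(\<Sum>i. 1 / real (c (Suc i))) < 1 / 2"
    and "\<alpha> > 1"
    and "eventually (\<lambda>j. real (c j) \<le> \<alpha> ^ j) sequentially"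
    and "0 < \<epsilon>" and "\<epsilon> < 1"
  shows "liminf (\<lambda>n. ereal (real (complexity (eta (B_set c)) n) /
           real n powr (\<epsilon> * log (2 * \<alpha>) (log (2 * \<alpha>) (real n))))) = \<infinity>"
proof -
  define \<beta> where "\<beta> = 2 * \<alpha>"
  have \<beta>: "\<beta> > 1" using assms(8) by (simp add: \<beta>_def)
  define \<delta> where "\<delta> = (1 + \<epsilon>) / 2"
  have \<delta>: "0 < \<delta>" "\<epsilon> < \<delta>" "\<delta> < 1" using assms(10,11) by (auto simp: \<delta>_def)
  obtain j0 where j0: "\<And>j. j \<ge> j0 \<Longrightarrow> real (c j) \<le> \<alpha> ^ j"
    using assms(9) by (auto simp: eventually_sequentially)
  \<comment> \<open>With \<open>m\<close> the logarithm of \<open>n\<close>, this is the exponent of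
    the lower bound for \<open>fact K\<close>, taken at \<open>\<delta> * m - 1 \<le> K\<close>,
    minus that of the denominator. It grows like
    \<open>(\<delta> - \<epsilon>) * m * ln m\<close>.\<close>
  define g where "g = (\<lambda>m::real. ((\<delta> * m - 1) * (ln (\<delta> * m - 1) - 1)) - \<epsilon> * (m * ln m))"
  have log_top: "filterlim (\<lambda>n. log \<beta> (real n)) at_top sequentially"
    using \<beta> by real_asymp
  have "filterlim g at_top at_top"
    unfolding g_def using \<delta> assms(10) by real_asymp
  then have "filterlim (\<lambda>n. exp (g (log \<beta> (real n)))) at_top sequentially"
    using log_top by (rule filterlim_compose[OF exp_at_top filterlim_compose])
  moreover have "\<forall>\<^sub>F n in sequentially. exp (g (log \<beta> (real n))) \<le>
      real (complexity (eta (B_set c)) n) / real n powr (\<epsilon> * log \<beta> (log \<beta> (real n)))"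
  proof -
    \<comment> \<open>The gap between \<open>\<delta>\<close> and 1 absorbs the factor
      \<open>12 * K\<close>.\<close>
    have "\<forall>\<^sub>F m in at_top. 12 * (\<delta> * m) * \<beta> powr (\<delta> * m) \<le> \<beta> powr m"
      using \<delta> \<beta> by real_asymp
    \<comment> \<open>This ensures both \<open>K \<ge> j0\<close> and
      \<open>\<delta> * m - 1 \<ge> 3 \<ge> exp 1\<close>; the latter keeps the factor
      \<open>ln (\<delta> * m - 1) - 1\<close> nonnegative when products are compared.\<close>
    moreover have "\<forall>\<^sub>F m in at_top. \<delta> * m \<ge> real j0 + 4"
      using \<delta> by real_asymp
    ultimately have "\<forall>\<^sub>F m in at_top. 12 * (\<delta> * m) * \<beta> powr (\<delta> * m) \<le> \<beta> powr m \<and> \<delta> * m \<ge> real j0 + 4"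
      by (rule eventually_conj)
    then have "\<forall>\<^sub>F n in sequentially. 12 * (\<delta> * log \<beta> (real n)) * \<beta> powr (\<delta> * log \<beta> (real n)) \<le> \<beta> powr log \<beta> (real n)
        \<and> \<delta> * log \<beta> (real n) \<ge> real j0 + 4"
      using log_top by (rule eventually_compose_filterlim)
    then show ?thesis
      using eventually_gt_at_top[of 0]
    proof eventually_elim
      case (elim n)
      define m where "m = log \<beta> (real n)"
      define K where "K = nat \<lfloor>\<delta> * m\<rfloor>"
      have n: "real n = \<beta> powr m" using elim \<beta> by (simp add: m_def)
      have big: "\<delta> * m \<ge> real j0 + 4" using elim by (simp add: m_def)
      have m0: "m > 0" using big \<delta> by (smt (verit) of_nat_0_le_iff mult_nonneg_nonpos)
      have K: "real K \<le> \<delta> * m" "\<delta> * m - 1 \<le> real K" using big by (auto simp: K_def)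
      then have "K \<ge> j0" using big by linarith
      then have "2 ^ K * real (c K) \<le> 2 ^ K * \<alpha> ^ K"
        using j0 by simp
      also have "\<dots> = \<beta> powr real K"
        using \<beta> by (simp add: \<beta>_def power_mult_distrib powr_realpow)
      also have "\<dots> \<le> \<beta> powr (\<delta> * m)"
        using \<beta> K by (intro powr_mono) auto
      finally have "(12 * real K) * (2 ^ K * real (c K)) \<le> (12 * (\<delta> * m)) * \<beta> powr (\<delta> * m)"
        using K big by (intro mult_mono) auto
      also have "\<dots> \<le> \<beta> powr m"
        using elim(1) unfolding m_def by (rule conjunct1)
      also have "\<dots> = real n"
        by (rule n[symmetric])
      finally have "real (12 * K * 2 ^ K * c K) \<le> real n"
        by (simp add: mult.assoc)
      then have "fact K \<le> complexity (eta (B_set c)) n"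
        by (intro fact_le_complexity assms(1-7)) (simp_all only: of_nat_le_iff)
      then have F: "fact K \<le> real (complexity (eta (B_set c)) n)"
        by (metis of_nat_fact of_nat_le_iff)
      have ln3: "1 \<le> ln (\<delta> * m - 1)"
      proof -
        have "exp 1 \<le> \<delta> * m - 1" using exp_le big by linarith
        then show ?thesis by (metis exp_gt_zero ln_exp ln_le_cancel_iff order_less_le_trans)
      qed
      have "(\<delta> * m - 1) * (ln (\<delta> * m - 1) - 1) \<le> real K * (ln (real K) - 1)"
        using K big ln3 by (intro mult_mono) auto
      then have "exp ((\<delta> * m - 1) * (ln (\<delta> * m - 1) - 1)) \<le> exp (real K * (ln (real K) - 1))"
        by simp
      also note exp_mult_ln_le_fact
      also note F
      finally have C: "exp ((\<delta> * m - 1) * (ln (\<delta> * m - 1) - 1)) \<le> real (complexity (eta (B_set c)) n)" .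
      \<comment> \<open>The factor \<open>ln \<beta>\<close> from \<open>n = \<beta> powr m\<close>
        cancels the one in \<open>log \<beta> m\<close>.\<close>
      have "real n powr (\<epsilon> * log \<beta> m) = exp (\<epsilon> * (m * ln m))"
        using \<beta> by (simp add: n powr_powr) (simp add: powr_def log_def)
      then show ?case
        using C by (simp add: g_def exp_diff divide_right_mono flip: m_def)
    qed
  qed
  ultimately have "filterlim (\<lambda>n. real (complexity (eta (B_set c)) n) /
      real n powr (\<epsilon> * log \<beta> (log \<beta> (real n)))) at_top sequentially"
    by (rule filterlim_at_top_mono)
  then have "((\<lambda>n. ereal (real (complexity (eta (B_set c)) n) /
      real n powr (\<epsilon> * log \<beta> (log \<beta> (real n))))) \<longlongrightarrow> \<infinity>) sequentially"
    by (simp only: tendsto_PInfty_eq_at_top)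
  then show ?thesis
    unfolding \<beta>_def by (rule lim_imp_Liminf[OF sequentially_bot])
qed

end
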